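(* There is an absolute constant $C$ such that for every $d\ge1$ there is a probability distribution $\Upsilon_d$ over matrices $X\in\mathbb R^{d\times d}$ with continuously differentiable density $q(X)$ supported on $\{\|X\|\le1\}$, such that the trace of the Fisher information matrix $J_{\Upsilon_d}$ of the distribution satisfies $$ \operatorname{Tr}J_{\Upsilon_d}=\sum_{i,j=1}^d\mathbb E_{\Upsilon_d}\Bigl[\frac{\partial}{\partial x_{ij}}\log q(X)\Bigr]^2\;\le\;C\,d^3. $$
   Context: $\|X\|$ is the spectral (operator) norm. The density is with respect to Lebesgue measure on $\mathbb R^{d\times d}$. *)

theory Defs
  imports "HOL-Probability.Probability"
begin

text \<open>
  The dimension \<^term>\<open>d\<close> is quantified below an existential constant, so it cannot be a type
  parameter.  A matrix in \<open>\<real>\<^sup>d\<^sup>\<times>\<^sup>d\<close> is a function \<open>X :: nat \<times> nat \<Rightarrow> real\<close> that is extensional on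
  \<open>{..<d} \<times> {..<d}\<close>, with entries \<open>X (i, j)\<close>.  On these functions the product topology of
  \<open>nat \<times> nat \<Rightarrow> real\<close> restricts to the Euclidean topology.
\<close>

type_synonym rmat = "nat \<times> nat \<Rightarrow> real"

definition mat_lborel :: "nat \<Rightarrow> rmat measure" where
  "mat_lborel d = (\<Pi>\<^sub>M p\<in>{..<d} \<times> {..<d}. lborel)"

definition spectral_norm :: "nat \<Rightarrow> rmat \<Rightarrow> real" where
  "spectral_norm d X =
     (SUP v\<in>{v. L2_set v {..<d} \<le> 1}. L2_set (\<lambda>i. \<Sum>j<d. X (i, j) * v j) {..<d})"

definition partial_deriv :: "nat \<times> nat \<Rightarrow> (rmat \<Rightarrow> real) \<Rightarrow> rmat \<Rightarrow> real" where
  "partial_deriv p f X = deriv (\<lambda>t. f (X(p := t))) (X p)"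

definition continuously_differentiable :: "nat \<Rightarrow> (rmat \<Rightarrow> real) \<Rightarrow> bool" where
  "continuously_differentiable d f \<longleftrightarrow>
     (\<forall>p\<in>{..<d} \<times> {..<d}.
        (\<forall>X\<in>space (mat_lborel d). (\<lambda>t. f (X(p := t))) differentiable (at (X p))) \<and>
        continuous_on (space (mat_lborel d)) (partial_deriv p f))"

definition has_density :: "nat \<Rightarrow> rmat measure \<Rightarrow> (rmat \<Rightarrow> real) \<Rightarrow> bool" where
  "has_density d \<Upsilon> q \<longleftrightarrow>
     q \<in> borel_measurable (mat_lborel d) \<and> (\<forall>X\<in>space (mat_lborel d). 0 \<le> q X) \<and>
     \<Upsilon> = density (mat_lborel d) (\<lambda>X. ennreal (q X))"

text \<open>
  The logarithmic derivative makes sense only where the density is positive, which is almost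
  everywhere for the distribution; the value \<open>0\<close> elsewhere does not affect any expectation.
\<close>

definition score :: "(rmat \<Rightarrow> real) \<Rightarrow> nat \<times> nat \<Rightarrow> rmat \<Rightarrow> real" where
  "score q p X = (if 0 < q X then partial_deriv p (\<lambda>Y. ln (q Y)) X else 0)"

definition fisher_information ::
    "rmat measure \<Rightarrow> (rmat \<Rightarrow> real) \<Rightarrow> nat \<times> nat \<Rightarrow> nat \<times> nat \<Rightarrow> real" where
  "fisher_information \<Upsilon> q p p' = (\<integral>X. score q p X * score q p' X \<partial>\<Upsilon>)"

definition fisher_trace :: "nat \<Rightarrow> rmat measure \<Rightarrow> (rmat \<Rightarrow> real) \<Rightarrow> real" where
  "fisher_trace d \<Upsilon> q = (\<Sum>p\<in>{..<d} \<times> {..<d}. fisher_information \<Upsilon> q p p)"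

end

theory Submission
  imports Defs
begin

text \<open>
  The density is that of a Gaussian matrix with independent entries of standard deviation \<open>s\<close> of order
  \<open>1 / \<surd>d\<close>, multiplied by a cutoff that keeps the spectral norm below \<open>1\<close>. The Gaussian alone has Fisher
  information \<open>1 / s\<^sup>2\<close> per entry, hence a trace of order \<open>d\<^sup>2 \<cdot> d\<close>, so it remains to cut off smoothly
  without removing most of the mass and without exceeding this order.

  The spectral norm is not differentiable. It is replaced by an exponential sum over a finite net: if
  \<open>N\<close> is a \<open>1/4\<close>-net of the unit ball, the spectral norm is at most twice the maximum of \<open>u \<cdot> Xv\<close>
  over \<open>u\<close>, \<open>v\<close> in \<open>N\<close> (\<open>spectral_norm_le_of_net\<close>), and this maximum is controlled by
  \<open>\<Phi>(X) = \<Sum> exp (l (u \<cdot> Xv))\<close>. The cutoff is \<open>h\<^sup>2\<close> with \<open>h = max 0 (1 - \<Phi> / B)\<close>, which vanishes unless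
  every \<open>u \<cdot> Xv\<close> is at most \<open>ln B / l\<close>. The net has at most \<open>exp (18 d)\<close> points (\<open>card_net_le\<close>), and for
  \<open>l\<close> of order \<open>d\<close> the Gaussian expectation of each exponential is \<open>exp (O(d))\<close>; so \<open>B = exp (O(d))\<close>
  can be chosen such that \<open>\<Phi>\<close> has expectation at most \<open>B/4\<close>, which leaves at least half of the mass
  (\<open>mass_ge_half\<close>), while \<open>ln B / l = 1/2\<close>.

  The gradient of \<open>\<Phi>\<close> has length at most \<open>l \<Phi>\<close> because every form \<open>u \<cdot> Xv\<close> has a coefficient
  vector of length at most \<open>1\<close> (\<open>sum_soft_max_deriv_le\<close>). On the support \<open>\<Phi> \<le> B\<close>, so \<open>h\<close> is
  \<open>l\<close>-Lipschitz, and the square on \<open>h\<close> makes its contribution to the Fisher information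
  at most a multiple of \<open>l\<^sup>2\<close>, that is \<open>O(d\<^sup>2)\<close>. This is below the Gaussian contribution \<open>O(d\<^sup>3)\<close>
  (\<open>fisher_information_sum_le\<close>).
\<close>

section \<open>A net of the Euclidean unit ball and the spectral norm\<close>

text \<open>
  The integer vectors \<open>z\<close> stand for the points \<open>z / (4 \<surd>d)\<close>, which lie in the Euclidean unit
  ball and approximate each of its points up to \<open>1/4\<close>. Keeping the integers makes the net easy to count.
\<close>

definition net :: "nat \<Rightarrow> (nat \<Rightarrow> int) set" where
  "net d = {z \<in> {..<d} \<rightarrow>\<^sub>E UNIV. (\<Sum>i<d. (z i)\<^sup>2) \<le> 16 * int d}"

lemma int_abs_le_power2: "\<bar>x\<bar> \<le> x\<^sup>2" for x :: int
proof (cases "x = 0")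
  case False
  then have "\<bar>x\<bar> * 1 \<le> \<bar>x\<bar> * \<bar>x\<bar>" by (intro mult_left_mono) auto
  then show ?thesis by (simp add: power2_eq_square)
qed simp

lemma net_coordinate_bound:
  assumes "z \<in> net d" "i < d"
  shows "\<bar>z i\<bar> \<le> 16 * int d"
proof -
  have "\<bar>z i\<bar> \<le> (z i)\<^sup>2"
    by (rule int_abs_le_power2)
  also have "\<dots> \<le> (\<Sum>i<d. (z i)\<^sup>2)"
    using assms(2) by (intro member_le_sum) auto
  also have "\<dots> \<le> 16 * int d"
    using assms(1) by (simp add: net_def)
  finally show ?thesis .
qed

lemma net_subset_box: "net d \<subseteq> {..<d} \<rightarrow>\<^sub>E {- 16 * int d..16 * int d}"
proof
  fix z assume z: "z \<in> net d"
  then have "z \<in> extensional {..<d}" by (auto simp: net_def PiE_def)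
  with net_coordinate_bound[OF z] show "z \<in> {..<d} \<rightarrow>\<^sub>E {- 16 * int d..16 * int d}"
    by (auto simp: PiE_def Pi_def abs_le_iff) (smt (verit))+
qed

lemma finite_net: "finite (net d)"
  by (rule finite_subset[OF net_subset_box]) (auto intro: finite_PiE)

lemma sum_half_powers_le:
  "(\<Sum>z\<in>{- int n..int n}. (1/2::real) ^ nat \<bar>z\<bar>) \<le> 3"
proof -
  have "(\<Sum>z\<in>{- int n..int n}. (1/2::real) ^ nat \<bar>z\<bar>) = 3 - 2 * (1/2) ^ n"
  proof (induction n)
    case (Suc n)
    have "{- int (Suc n)..int (Suc n)} =
        insert (int (Suc n)) (insert (- int (Suc n)) {- int n..int n})"
      by auto
    with Suc show ?case by (simp add: nat_add_distrib)
  qed simp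
  then show ?thesis by simp
qed

lemma sum_prod_PiE:
  fixes f :: "'b \<Rightarrow> real"
  assumes "finite I" "finite A"
  shows "(\<Sum>z\<in>I \<rightarrow>\<^sub>E A. \<Prod>i\<in>I. f (z i)) = (\<Sum>a\<in>A. f a) ^ card I"
  using prod_sum_PiE[OF assms(1), of "\<lambda>_. A" "\<lambda>_. f"] assms by simp

text \<open>
  A Chernoff bound for counting: give \<open>z\<close> the weight \<open>2 ^ (16 d) \<cdot> (\<Prod>i<d. (1/2) ^ \<bar>z i\<bar>)\<close>. Since
  \<open>\<bar>z i\<bar> \<le> (z i)\<^sup>2\<close> for integers, every point of the net has weight at least \<open>1\<close>, and the sum of the weights
  over a whole box factorises into \<open>d\<close> geometric sums.
\<close>

lemma card_net_le: "real (card (net d)) \<le> exp (18 * real d)"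
proof -
  let ?B = "{..<d} \<rightarrow>\<^sub>E {- 16 * int d..16 * int d}"
  have "real (card (net d)) = (\<Sum>z\<in>net d. 1)" by simp
  also have "\<dots> \<le> (\<Sum>z\<in>net d. 2 ^ (16 * d) * (\<Prod>i<d. (1/2::real) ^ nat \<bar>z i\<bar>))"
  proof (rule sum_mono)
    fix z assume z: "z \<in> net d"
    have "int (\<Sum>i<d. nat \<bar>z i\<bar>) \<le> int (\<Sum>i<d. nat ((z i)\<^sup>2))"
      by (intro of_nat_mono sum_mono nat_mono int_abs_le_power2)
    also have "\<dots> = (\<Sum>i<d. (z i)\<^sup>2)" by simp
    also have "\<dots> \<le> int (16 * d)" using z by (simp add: net_def)
    finally have "(\<Sum>i<d. nat \<bar>z i\<bar>) \<le> 16 * d" by linarith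
    then have "(1/2::real) ^ (16 * d) \<le> (1/2) ^ (\<Sum>i<d. nat \<bar>z i\<bar>)"
      by (intro power_decreasing) auto
    then have "2 ^ (16 * d) * (1/2::real) ^ (16 * d) \<le>
        2 ^ (16 * d) * (1/2) ^ (\<Sum>i<d. nat \<bar>z i\<bar>)"
      by (intro mult_left_mono) auto
    then show "1 \<le> 2 ^ (16 * d) * (\<Prod>i<d. (1/2::real) ^ nat \<bar>z i\<bar>)"
      by (simp add: power_sum power_mult_distrib[symmetric])
  qed
  also have "\<dots> \<le> (\<Sum>z\<in>?B. 2 ^ (16 * d) * (\<Prod>i<d. (1/2::real) ^ nat \<bar>z i\<bar>))"
    using net_subset_box[of d] by (intro sum_mono2) (auto intro!: finite_PiE prod_nonneg mult_nonneg_nonneg)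
  also have "\<dots> = 2 ^ (16 * d) * (\<Sum>a\<in>{- int (16 * d)..int (16 * d)}. (1/2) ^ nat \<bar>a\<bar>) ^ d"
    using sum_prod_PiE[of "{..<d}" "{- 16 * int d..16 * int d}" "\<lambda>a. (1/2) ^ nat \<bar>a\<bar>"]
    by (simp add: sum_distrib_left[symmetric])
  also have "\<dots> \<le> 2 ^ (16 * d) * 4 ^ d"
    using sum_half_powers_le[of "16 * d"]
    by (intro mult_left_mono power_mono) (auto intro!: sum_nonneg)
  also have "\<dots> = (2::real) ^ (16 * d + 2 * d)"
    unfolding power_add by (simp add: power_mult)
  also have "\<dots> = (2::real) ^ (18 * d)" by simp
  also have "\<dots> \<le> exp 1 ^ (18 * d)"
    using exp_ge_add_one_self[of "1::real"] by (intro power_mono) auto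
  also have "\<dots> = exp (18 * real d)" by (simp add: exp_of_nat_mult[symmetric])
  finally show ?thesis .
qed

lemma L2_set_power2: "(L2_set f A)\<^sup>2 = (\<Sum>i\<in>A. (f i)\<^sup>2)"
  by (simp add: L2_set_def sum_nonneg)

lemma inner_le_L2_set: "(\<Sum>i\<in>A. f i * g i) \<le> L2_set f A * L2_set g A"
proof -
  have "(\<Sum>i\<in>A. f i * g i) \<le> (\<Sum>i\<in>A. \<bar>f i\<bar> * \<bar>g i\<bar>)"
    by (intro sum_mono) (metis abs_ge_self abs_mult)
  with L2_set_mult_ineq[of f g A] show ?thesis by linarith
qed

lemma L2_set_scale: "L2_set (\<lambda>i. c * f i) A = \<bar>c\<bar> * L2_set f A"
  by (simp add: L2_set_def power_mult_distrib sum_distrib_left[symmetric] real_sqrt_mult)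

text \<open>
  Rounding \<open>4 \<surd>d v\<close> towards zero does not increase any coordinate in absolute value, so the result stays
  in the net, and it moves each coordinate by at most \<open>1\<close>, hence \<open>v\<close> by at most
  \<open>\<surd>d / (4 \<surd>d)\<close> in Euclidean norm.
\<close>

lemma net_rounding:
  assumes "d \<ge> 1" and v: "L2_set v {..<d} \<le> 1"
  obtains z where "z \<in> net d" "L2_set (\<lambda>i. v i - of_int (z i) / (4 * sqrt d)) {..<d} \<le> 1/4"
proof -
  define r where "r = 4 * sqrt (real d)"
  have r: "r > 0" "r\<^sup>2 = 16 * real d"
    using assms(1) by (simp_all add: r_def power_mult_distrib)
  define z where "z = (\<lambda>i\<in>{..<d}. if v i \<ge> 0 then \<lfloor>r * v i\<rfloor> else \<lceil>r * v i\<rceil>)"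
  have sq: "(\<Sum>i<d. (v i)\<^sup>2) \<le> 1"
    using v by (simp add: L2_set_def)
  have z1: "\<bar>real_of_int (z i)\<bar> \<le> \<bar>r * v i\<bar>" if "i < d" for i
  proof (cases "v i \<ge> 0")
    case True
    then have "0 \<le> r * v i" using r by simp
    with True that show ?thesis by (auto simp: z_def)
  next
    case False
    then have "r * v i \<le> 0" using r by (simp add: mult_le_0_iff)
    with False that show ?thesis by (auto simp: z_def)
  qed
  have z2: "\<bar>r * v i - real_of_int (z i)\<bar> \<le> 1" if "i < d" for i
    using that by (auto simp: z_def) linarith+
  have "real_of_int (\<Sum>i<d. (z i)\<^sup>2) = (\<Sum>i<d. \<bar>real_of_int (z i)\<bar>\<^sup>2)" by simp
  also have "\<dots> \<le> (\<Sum>i<d. \<bar>r * v i\<bar>\<^sup>2)" by (intro sum_mono power_mono z1) auto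
  also have "\<dots> = r\<^sup>2 * (\<Sum>i<d. (v i)\<^sup>2)" by (simp add: power_mult_distrib sum_distrib_left)
  also have "\<dots> \<le> r\<^sup>2 * 1" by (intro mult_left_mono sq) auto
  finally have "real_of_int (\<Sum>i<d. (z i)\<^sup>2) \<le> real_of_int (16 * int d)" by (simp add: r)
  then have "(\<Sum>i<d. (z i)\<^sup>2) \<le> 16 * int d" by (simp only: of_int_le_iff)
  then have mem: "z \<in> net d" by (auto simp: net_def z_def)
  have "(\<Sum>i<d. (v i - of_int (z i) / r)\<^sup>2) \<le> (\<Sum>i<d. 1 / r\<^sup>2)"
  proof (intro sum_mono)
    fix i assume "i \<in> {..<d}"
    then have "\<bar>r * v i - real_of_int (z i)\<bar>\<^sup>2 \<le> 1\<^sup>2" by (intro power_mono z2) auto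
    moreover have "(v i - of_int (z i) / r)\<^sup>2 = (r * v i - real_of_int (z i))\<^sup>2 / r\<^sup>2"
      using r by (simp add: field_simps)
    ultimately show "(v i - of_int (z i) / r)\<^sup>2 \<le> 1 / r\<^sup>2"
      by (simp add: divide_right_mono)
  qed
  also have "\<dots> = (1/4)\<^sup>2" using assms(1) by (simp add: r(2) power2_eq_square[of "1/4"])
  finally have "L2_set (\<lambda>i. v i - of_int (z i) / r) {..<d} \<le> 1/4"
    unfolding L2_set_def by (intro real_le_lsqrt) auto
  with mem that show thesis by (simp add: r_def)
qed

lemma net_point_norm:
  assumes "d \<ge> 1" "z \<in> net d"
  shows "(\<Sum>i<d. (of_int (z i))\<^sup>2 :: real) \<le> 16 * real d"
    and "L2_set (\<lambda>i. of_int (z i) / (4 * sqrt d)) {..<d} \<le> 1"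
proof -
  have "real_of_int (\<Sum>i<d. (z i)\<^sup>2) \<le> real_of_int (16 * int d)"
    using assms(2) by (simp only: of_int_le_iff net_def) simp
  then show *: "(\<Sum>i<d. (of_int (z i))\<^sup>2 :: real) \<le> 16 * real d" by simp
  have "(\<Sum>i<d. (of_int (z i) / (4 * sqrt d))\<^sup>2) = (\<Sum>i<d. (of_int (z i))\<^sup>2) / (16 * real d)"
    by (simp add: power_divide power_mult_distrib sum_divide_distrib)
  also have "\<dots> \<le> 1" using * assms(1) by simp
  finally show "L2_set (\<lambda>i. of_int (z i) / (4 * sqrt d)) {..<d} \<le> 1"
    by (simp add: L2_set_def)
qed

definition mat_vec :: "nat \<Rightarrow> rmat \<Rightarrow> (nat \<Rightarrow> real) \<Rightarrow> nat \<Rightarrow> real" where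
  "mat_vec d X v i = (\<Sum>j<d. X (i, j) * v j)"

text \<open>
  The supremum that defines the spectral norm is a real supremum, so it controls \<open>\<bar>Xv\<bar>\<close> only once the set is
  known to be bounded; the sum of the absolute values of all entries is a crude bound.
\<close>

lemma spectral_norm_upper:
  assumes "L2_set v {..<d} \<le> c" "c > 0"
  shows "L2_set (mat_vec d X v) {..<d} \<le> spectral_norm d X * c"
proof -
  have bdd: "bdd_above ((\<lambda>v. L2_set (mat_vec d X v) {..<d}) ` {v. L2_set v {..<d} \<le> 1})"
  proof (rule bdd_aboveI2)
    fix v assume "v \<in> {v. L2_set v {..<d} \<le> 1}"
    then have v: "L2_set v {..<d} \<le> 1" by simp
    have vj: "\<bar>v j\<bar> \<le> 1" if "j < d" for j
      using member_le_L2_set[of "{..<d}" j "\<lambda>i. \<bar>v i\<bar>"] that v order_trans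
      by (fastforce simp: L2_set_def)
    have "L2_set (mat_vec d X v) {..<d} \<le> (\<Sum>i<d. \<bar>mat_vec d X v i\<bar>)"
      by (rule L2_set_le_sum_abs)
    also have "\<dots> \<le> (\<Sum>i<d. \<Sum>j<d. \<bar>X (i, j)\<bar>)"
    proof (intro sum_mono)
      fix i
      have "\<bar>mat_vec d X v i\<bar> \<le> (\<Sum>j<d. \<bar>X (i, j) * v j\<bar>)"
        unfolding mat_vec_def by (rule sum_abs)
      also have "\<dots> \<le> (\<Sum>j<d. \<bar>X (i, j)\<bar>)"
        using vj by (intro sum_mono) (simp add: abs_mult mult_left_le)
      finally show "\<bar>mat_vec d X v i\<bar> \<le> (\<Sum>j<d. \<bar>X (i, j)\<bar>)" .
    qed
    finally show "L2_set (mat_vec d X v) {..<d} \<le> (\<Sum>i<d. \<Sum>j<d. \<bar>X (i, j)\<bar>)" .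
  qed
  have "L2_set (\<lambda>i. (1 / c) * v i) {..<d} \<le> 1"
    unfolding L2_set_scale using assms by simp
  then have "L2_set (mat_vec d X (\<lambda>i. (1 / c) * v i)) {..<d} \<le> spectral_norm d X"
    using bdd unfolding spectral_norm_def mat_vec_def[abs_def] by (intro cSUP_upper) auto
  moreover have "mat_vec d X (\<lambda>i. (1 / c) * v i) = (\<lambda>i. (1 / c) * mat_vec d X v i)"
    by (simp add: mat_vec_def fun_eq_iff sum_distrib_left ac_simps)
  ultimately have "(1 / c) * L2_set (mat_vec d X v) {..<d} \<le> spectral_norm d X"
    using assms(2) L2_set_scale[of "1 / c" "mat_vec d X v" "{..<d}"] by simp
  then show ?thesis using assms(2) by (simp add: field_simps)
qed

text \<open>
  Let \<open>S\<close> be the spectral norm and approximate \<open>u\<close>, \<open>v\<close> in the unit ball by net points \<open>n\<close>, \<open>n'\<close>. Then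
  \<open>u \<cdot> Xv = n \<cdot> Xn' + n \<cdot> X(v - n') + (u - n) \<cdot> Xv \<le> m + S/4 + S/4\<close>. Taking \<open>u\<close> in the direction of
  \<open>Xv\<close> turns this into \<open>S \<le> m + S/2\<close>.
\<close>

lemma spectral_norm_le_of_net:
  assumes d: "d \<ge> 1"
    and m: "\<And>z w. z \<in> net d \<Longrightarrow> w \<in> net d \<Longrightarrow>
      (\<Sum>i<d. \<Sum>j<d. of_int (z i) * of_int (w j) / (16 * real d) * X (i, j)) \<le> m"
  shows "spectral_norm d X \<le> 2 * m"
proof -
  define r where "r = 4 * sqrt (real d)"
  have r: "r > 0" "r * r = 16 * real d" using d by (auto simp: r_def)
  let ?S = "spectral_norm d X" and ?L = "\<lambda>v. L2_set v {..<d}"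
  have "?L (\<lambda>_. 0) \<le> 1" by (simp add: L2_set_def)
  from spectral_norm_upper[OF this, of X] have S0: "0 \<le> ?S"
    using L2_set_nonneg[of "mat_vec d X (\<lambda>_. 0)" "{..<d}"] by linarith
  have m0: "0 \<le> m"
    using m[of "\<lambda>i\<in>{..<d}. 0" "\<lambda>i\<in>{..<d}. 0"] by (simp add: net_def)
  have add: "mat_vec d X v i = mat_vec d X v' i + mat_vec d X (\<lambda>j. v j - v' j) i" for v v' i
    by (simp add: mat_vec_def sum.distrib[symmetric] algebra_simps)
  have "?L (mat_vec d X v) \<le> m + ?S / 2" if v: "?L v \<le> 1" for v
  proof (cases "?L (mat_vec d X v) = 0")
    case True
    then show ?thesis using m0 S0 by simp
  next
    case False
    let ?y = "mat_vec d X v"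
    define u where "u = (\<lambda>i. (1 / ?L ?y) * ?y i)"
    have pos: "?L ?y > 0" using False by (simp add: less_le)
    have u: "?L u \<le> 1" using pos unfolding u_def L2_set_scale by simp
    have yu: "?L ?y = (\<Sum>i<d. u i * ?y i)"
    proof -
      have "(\<Sum>i<d. u i * ?y i) = (1 / ?L ?y) * (?L ?y)\<^sup>2"
        unfolding L2_set_power2 by (simp add: u_def sum_distrib_left power2_eq_square)
      then show ?thesis using pos by (simp add: power2_eq_square)
    qed
    obtain z where z: "z \<in> net d" "?L (\<lambda>i. u i - of_int (z i) / r) \<le> 1/4"
      using net_rounding[OF d u] unfolding r_def by blast
    obtain w where w: "w \<in> net d" "?L (\<lambda>i. v i - of_int (w i) / r) \<le> 1/4"
      using net_rounding[OF d v] unfolding r_def by blast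
    let ?n = "\<lambda>i. of_int (z i) / r" and ?n' = "\<lambda>i. of_int (w i) / r"
    have "(\<Sum>i<d. ?n i * mat_vec d X ?n' i) =
        (\<Sum>i<d. \<Sum>j<d. of_int (z i) * of_int (w j) / (16 * real d) * X (i, j))"
      unfolding r(2)[symmetric] mat_vec_def by (simp add: sum_distrib_left ac_simps)
    with m[OF z(1) w(1)] have 1: "(\<Sum>i<d. ?n i * mat_vec d X ?n' i) \<le> m" by simp
    have "(\<Sum>i<d. ?n i * mat_vec d X (\<lambda>j. v j - ?n' j) i) \<le>
        ?L ?n * ?L (mat_vec d X (\<lambda>j. v j - ?n' j))"
      by (rule inner_le_L2_set)
    also have "\<dots> \<le> 1 * (?S * (1/4))"
      using net_point_norm(2)[OF d z(1)] spectral_norm_upper[OF w(2)]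
      by (intro mult_mono) (auto simp: r_def)
    finally have 2: "(\<Sum>i<d. ?n i * mat_vec d X (\<lambda>j. v j - ?n' j) i) \<le> ?S / 4" by simp
    have "(\<Sum>i<d. (u i - ?n i) * ?y i) \<le> ?L (\<lambda>i. u i - ?n i) * ?L ?y"
      by (rule inner_le_L2_set)
    also have "\<dots> \<le> (1/4) * (?S * 1)"
      using z(2) spectral_norm_upper[OF v] by (intro mult_mono) auto
    finally have 3: "(\<Sum>i<d. (u i - ?n i) * ?y i) \<le> ?S / 4" by simp
    have "(\<Sum>i<d. u i * ?y i) = (\<Sum>i<d. ?n i * mat_vec d X ?n' i)
        + (\<Sum>i<d. ?n i * mat_vec d X (\<lambda>j. v j - ?n' j) i) + (\<Sum>i<d. (u i - ?n i) * ?y i)"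
      unfolding sum.distrib[symmetric]
    proof (intro sum.cong refl)
      fix i
      show "u i * ?y i = ?n i * mat_vec d X ?n' i
          + ?n i * mat_vec d X (\<lambda>j. v j - ?n' j) i + (u i - ?n i) * ?y i"
        using add[of v i ?n'] by (simp only: distrib_left[symmetric] left_diff_distrib)
    qed
    with 1 2 3 yu show ?thesis by linarith
  qed
  then have "?S \<le> m + ?S / 2"
    unfolding spectral_norm_def mat_vec_def[abs_def]
    by (intro cSUP_least) (auto simp: mat_vec_def[abs_def] intro!: exI[of _ "\<lambda>_. 0"] simp: L2_set_def)
  then show ?thesis by linarith
qed

section \<open>One-dimensional Gaussian integrals and derivatives\<close>

text \<open>
  Completing the square: an exponential tilt of a centred Gaussian is a multiple of a shifted Gaussian,
  so the exponential moment can be read off without integrating.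
\<close>

lemma normal_density_times_exp:
  assumes "s > 0"
  shows "normal_density 0 s x * exp (b * x) = exp (b\<^sup>2 * s\<^sup>2 / 2) * normal_density (b * s\<^sup>2) s x"
proof -
  have "- (x - 0)\<^sup>2 / (2 * s\<^sup>2) + b * x = b\<^sup>2 * s\<^sup>2 / 2 + - (x - b * s\<^sup>2)\<^sup>2 / (2 * s\<^sup>2)"
    using assms by (simp add: field_simps power2_eq_square)
  then show ?thesis
    unfolding normal_density_def by (simp add: exp_add[symmetric] mult.assoc mult.left_commute)
qed

lemma normal_density_exp_moment:
  assumes "s > 0"
  shows "integrable lborel (\<lambda>x. normal_density 0 s x * exp (b * x))"
    and "(\<integral>x. normal_density 0 s x * exp (b * x) \<partial>lborel) = exp (b\<^sup>2 * s\<^sup>2 / 2)"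
  using assms by (simp_all add: normal_density_times_exp)

lemma normal_density_second_moment:
  assumes "s > 0"
  shows "integrable lborel (\<lambda>x. normal_density 0 s x * x\<^sup>2)"
    and "(\<integral>x. normal_density 0 s x * x\<^sup>2 \<partial>lborel) = s\<^sup>2"
  using integrable_normal_moment[OF assms, of 0 2] integral_normal_moment_even[OF assms, of 0 1]
  by (simp_all add: fact_numeral)

lemma has_real_derivative_normal_density:
  assumes "s > 0"
  shows "(normal_density 0 s has_real_derivative - x / s\<^sup>2 * normal_density 0 s x) (at x)"
  unfolding normal_density_def[abs_def] using assms
  by (auto intro!: derivative_eq_intros simp: field_simps power2_eq_square)

text \<open>
  The density contains the cutoff squared because the positive part alone has a kink at \<open>0\<close>.
\<close>

lemma has_real_derivative_pos_part_power2:
  "((\<lambda>x::real. (max 0 x)\<^sup>2) has_real_derivative 2 * max 0 x) (at x)"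
proof (cases x "0::real" rule: linorder_cases)
  case less
  then have "((\<lambda>_. 0) has_real_derivative 2 * max 0 x) (at x)" by simp
  then show ?thesis
    by (rule has_field_derivative_transform_within_open[of _ _ _ "{..<0}"]) (use less in auto)
next
  case equal
  have "((\<lambda>h. ((max 0 (0 + h))\<^sup>2 - (max 0 0)\<^sup>2) / h) \<longlongrightarrow> (0::real)) (at 0)"
  proof (rule Lim_null_comparison)
    show "\<forall>\<^sub>F h in at 0. norm (((max 0 (0 + h))\<^sup>2 - (max 0 0)\<^sup>2) / h) \<le> \<bar>h::real\<bar>"
      by (intro always_eventually) (auto simp: max_def power2_eq_square)
    show "((\<lambda>h::real. \<bar>h\<bar>) \<longlongrightarrow> 0) (at 0)" by (rule tendsto_rabs_zero) simp
  qed
  then show ?thesis using equal by (simp add: DERIV_def)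
next
  case greater
  then have "((\<lambda>y. y\<^sup>2) has_real_derivative 2 * max 0 x) (at x)"
    by (auto intro!: derivative_eq_intros)
  then show ?thesis
    by (rule has_field_derivative_transform_within_open[of _ _ _ "{0<..}"]) (use greater in auto)
qed

lemma sum_fun_upd:
  fixes f :: "'i \<Rightarrow> 'b \<Rightarrow> real"
  assumes "finite P" "p \<in> P"
  shows "(\<Sum>r\<in>P. f r ((X(p := t)) r)) = f p t + (\<Sum>r\<in>P - {p}. f r (X r))"
  using assms by (subst sum.remove[of _ p]) (auto intro!: sum.cong)

lemma prod_fun_upd:
  fixes f :: "'i \<Rightarrow> 'b \<Rightarrow> real"
  assumes "finite P" "p \<in> P"
  shows "(\<Prod>r\<in>P. f r ((X(p := t)) r)) = f p t * (\<Prod>r\<in>P - {p}. f r (X r))"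
  using assms by (subst prod.remove[of _ p]) (auto intro!: prod.cong)

interpretation lborel_product: product_sigma_finite "\<lambda>_ :: nat \<times> nat. lborel :: real measure"
  by standard

section \<open>Cutting off a Gaussian by finitely many linear forms\<close>

text \<open>
  The construction uses of the matrices only that their spectral norm is controlled by finitely many linear
  forms \<open>a k\<close> with coefficient vectors of length at most \<open>1\<close>, so it is carried out for an arbitrary finite set of such
  forms. The parameter \<open>s\<close> is the standard deviation of the Gaussian, \<open>l\<close> the sharpness of the soft
  maximum and \<open>B\<close> the level at which it is cut off. The bound on \<open>B\<close> ensures that the soft maximum has
  expectation at most \<open>B/4\<close>.
\<close>

locale gaussian_cutoff =
  fixes P :: "(nat \<times> nat) set" and K :: "'k set" and a :: "'k \<Rightarrow> rmat" and s l B :: real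
  assumes fin: "finite P" "finite K"
    and pos: "s > 0" "l \<ge> 0" "B > 0"
    and unit: "\<And>k. k \<in> K \<Longrightarrow> (\<Sum>p\<in>P. (a k p)\<^sup>2) \<le> 1"
    and small: "4 * card K * exp (l\<^sup>2 * s\<^sup>2 / 2) \<le> B"
begin

definition lin :: "'k \<Rightarrow> rmat \<Rightarrow> real" where
  "lin k X = (\<Sum>p\<in>P. a k p * X p)"

text \<open>
  Up to the logarithm this is the usual smooth maximum of the linear forms: at most \<open>B\<close> here forces every form
  to be at most \<open>ln B / l\<close>.
\<close>

definition soft_max :: "rmat \<Rightarrow> real" where
  "soft_max X = (\<Sum>k\<in>K. exp (l * lin k X))"

definition soft_max_deriv :: "nat \<times> nat \<Rightarrow> rmat \<Rightarrow> real" where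
  "soft_max_deriv p X = (\<Sum>k\<in>K. l * a k p * exp (l * lin k X))"

definition cutoff :: "rmat \<Rightarrow> real" where
  "cutoff X = max 0 (1 - soft_max X / B)"

definition gauss :: "rmat \<Rightarrow> real" where
  "gauss X = (\<Prod>p\<in>P. normal_density 0 s (X p))"

abbreviation leb :: "rmat measure" where
  "leb \<equiv> (\<Pi>\<^sub>M p\<in>P. lborel)"

definition mass :: real where
  "mass = (\<integral>X. gauss X * (cutoff X)\<^sup>2 \<partial>leb)"

definition dens :: "rmat \<Rightarrow> real" where
  "dens X = gauss X * (cutoff X)\<^sup>2 / mass"

abbreviation law :: "rmat measure" where
  "law \<equiv> density leb (\<lambda>X. ennreal (dens X))"

definition dens_deriv :: "nat \<times> nat \<Rightarrow> rmat \<Rightarrow> real" where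
  "dens_deriv p X =
     gauss X * cutoff X / mass * (- X p / s\<^sup>2 * cutoff X - 2 * soft_max_deriv p X / B)"

lemma gauss_pos: "gauss X > 0"
  unfolding gauss_def by (intro prod_pos normal_density_pos pos)

lemma soft_max_nonneg: "soft_max X \<ge> 0"
  unfolding soft_max_def by (intro sum_nonneg) auto

lemma cutoff_range: "0 \<le> cutoff X" "cutoff X \<le> 1"
  using soft_max_nonneg[of X] pos by (auto simp: cutoff_def)

lemma measurable_parts [measurable]:
  "gauss \<in> borel_measurable leb" "lin k \<in> borel_measurable leb"
  "soft_max \<in> borel_measurable leb" "cutoff \<in> borel_measurable leb"
  "dens \<in> borel_measurable leb"
  "p \<in> P \<Longrightarrow> soft_max_deriv p \<in> borel_measurable leb"
  "p \<in> P \<Longrightarrow> dens_deriv p \<in> borel_measurable leb"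
proof -
  show [measurable]: "gauss \<in> borel_measurable leb" unfolding gauss_def[abs_def] by measurable
  show [measurable]: "lin k \<in> borel_measurable leb" for k unfolding lin_def[abs_def] by measurable
  show [measurable]: "soft_max \<in> borel_measurable leb"
    unfolding soft_max_def[abs_def] by measurable
  show [measurable]: "cutoff \<in> borel_measurable leb" unfolding cutoff_def[abs_def] by measurable
  show "dens \<in> borel_measurable leb" unfolding dens_def[abs_def] by measurable
  have [measurable]: "soft_max_deriv p \<in> borel_measurable leb" for p
    unfolding soft_max_deriv_def[abs_def] by measurable
  then show "soft_max_deriv p \<in> borel_measurable leb" .
  show "dens_deriv p \<in> borel_measurable leb" if [measurable]: "p \<in> P"
    unfolding dens_deriv_def[abs_def] by measurable
qed

lemma gauss_weighted_prod:
  "gauss X * (\<Prod>p\<in>P. f p (X p)) = (\<Prod>p\<in>P. normal_density 0 s (X p) * f p (X p))"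
  by (simp add: gauss_def prod.distrib)

lemma gauss_integral:
  "integrable leb gauss" "(\<integral>X. gauss X \<partial>leb) = 1"
  using lborel_product.product_integrable_prod[OF fin(1), of "\<lambda>_. normal_density 0 s"]
    lborel_product.product_integral_prod[OF fin(1), of "\<lambda>_. normal_density 0 s"] pos
  by (simp_all add: gauss_def[abs_def])

lemma gauss_second_moment:
  assumes "p \<in> P"
  shows "integrable leb (\<lambda>X. gauss X * (X p)\<^sup>2)" "(\<integral>X. gauss X * (X p)\<^sup>2 \<partial>leb) = s\<^sup>2"
proof -
  let ?f = "\<lambda>r x. normal_density 0 s x * (if r = p then x\<^sup>2 else 1)"
  have int: "integrable lborel (?f r)" for r
    using normal_density_second_moment(1)[OF pos(1)] pos by (cases "r = p") simp_all
  have val: "(\<integral>x. ?f r x \<partial>lborel) = (if r = p then s\<^sup>2 else 1)" for r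
    using normal_density_second_moment(2)[OF pos(1)] pos by (cases "r = p") simp_all
  have eq: "(\<lambda>X. gauss X * (X p)\<^sup>2) = (\<lambda>X. \<Prod>r\<in>P. ?f r (X r))"
    using gauss_weighted_prod[of _ "\<lambda>r x. if r = p then x\<^sup>2 else 1"] assms fin
    by (simp add: fun_eq_iff prod.delta)
  show "integrable leb (\<lambda>X. gauss X * (X p)\<^sup>2)"
    unfolding eq by (rule lborel_product.product_integrable_prod[OF fin(1) int])
  show "(\<integral>X. gauss X * (X p)\<^sup>2 \<partial>leb) = s\<^sup>2"
    unfolding eq lborel_product.product_integral_prod[OF fin(1) int] val
    using assms fin by (simp add: prod.delta)
qed

lemma gauss_exp_moment:
  assumes "k \<in> K"
  shows "integrable leb (\<lambda>X. gauss X * exp (l * lin k X))"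
    and "(\<integral>X. gauss X * exp (l * lin k X) \<partial>leb) \<le> exp (l\<^sup>2 * s\<^sup>2 / 2)"
proof -
  let ?f = "\<lambda>p x. normal_density 0 s x * exp ((l * a k p) * x)"
  note int = normal_density_exp_moment(1)[OF pos(1)]
  have eq: "(\<lambda>X. gauss X * exp (l * lin k X)) = (\<lambda>X. \<Prod>p\<in>P. ?f p (X p))"
    using gauss_weighted_prod[of _ "\<lambda>p x. exp ((l * a k p) * x)"] fin
    by (simp add: fun_eq_iff lin_def sum_distrib_left exp_sum mult.assoc)
  show "integrable leb (\<lambda>X. gauss X * exp (l * lin k X))"
    unfolding eq by (rule lborel_product.product_integrable_prod[OF fin(1) int])
  have "(\<integral>X. gauss X * exp (l * lin k X) \<partial>leb) = (\<Prod>p\<in>P. exp ((l * a k p)\<^sup>2 * s\<^sup>2 / 2))"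
    unfolding eq lborel_product.product_integral_prod[OF fin(1) int]
    by (simp add: normal_density_exp_moment(2)[OF pos(1)])
  also have "\<dots> = exp (l\<^sup>2 * s\<^sup>2 / 2 * (\<Sum>p\<in>P. (a k p)\<^sup>2))"
    using fin by (simp add: exp_sum[symmetric] sum_distrib_left power_mult_distrib ac_simps)
  also have "\<dots> \<le> exp (l\<^sup>2 * s\<^sup>2 / 2 * 1)"
    using unit[OF assms] by (intro iffD2[OF exp_le_cancel_iff] mult_left_mono) auto
  finally show "(\<integral>X. gauss X * exp (l * lin k X) \<partial>leb) \<le> exp (l\<^sup>2 * s\<^sup>2 / 2)" by simp
qed

lemma gauss_soft_max:
  "integrable leb (\<lambda>X. gauss X * soft_max X)" "(\<integral>X. gauss X * soft_max X \<partial>leb) \<le> B / 4"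
proof -
  show "integrable leb (\<lambda>X. gauss X * soft_max X)"
    unfolding soft_max_def sum_distrib_left
    by (intro Bochner_Integration.integrable_sum gauss_exp_moment)
  have "(\<integral>X. gauss X * soft_max X \<partial>leb) = (\<Sum>k\<in>K. \<integral>X. gauss X * exp (l * lin k X) \<partial>leb)"
    unfolding soft_max_def sum_distrib_left
    by (intro Bochner_Integration.integral_sum gauss_exp_moment)
  also have "\<dots> \<le> (\<Sum>k\<in>K. exp (l\<^sup>2 * s\<^sup>2 / 2))" by (intro sum_mono gauss_exp_moment)
  also have "\<dots> \<le> B / 4" using small by simp
  finally show "(\<integral>X. gauss X * soft_max X \<partial>leb) \<le> B / 4" .
qed

lemma integrable_gauss_cutoff: "integrable leb (\<lambda>X. gauss X * (cutoff X)\<^sup>2)"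
proof (rule Bochner_Integration.integrable_bound[OF gauss_integral(1)])
  show "AE X in leb. norm (gauss X * (cutoff X)\<^sup>2) \<le> norm (gauss X)"
    using cutoff_range gauss_pos
    by (intro AE_I2) (auto simp: abs_mult less_imp_le power_le_one mult_left_le)
qed measurable

text \<open>
  Since \<open>(max 0 (1 - x))\<^sup>2 \<ge> 1 - 2 x\<close> for \<open>x \<ge> 0\<close>, the bound on the expectation of the soft maximum
  gives a lower bound for the mass at once.
\<close>

lemma mass_ge_half: "mass \<ge> 1/2"
proof -
  have "1 - 2 / B * (B / 4) \<le> 1 - 2 / B * (\<integral>X. gauss X * soft_max X \<partial>leb)"
    using gauss_soft_max(2) pos by (intro diff_left_mono mult_left_mono) auto
  also have "\<dots> = (\<integral>X. gauss X - 2 / B * (gauss X * soft_max X) \<partial>leb)"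
    using gauss_integral gauss_soft_max(1) by simp
  also have "\<dots> \<le> mass"
    unfolding mass_def
  proof (rule integral_mono)
    fix X
    have "1 - 2 * (soft_max X / B) \<le> (1 - soft_max X / B)\<^sup>2"
      by (simp add: power2_eq_square algebra_simps)
    moreover have "0 \<le> soft_max X / B" using soft_max_nonneg pos by simp
    ultimately have "1 - 2 * (soft_max X / B) \<le> (cutoff X)\<^sup>2"
      by (auto simp: cutoff_def max_def)
    then have "gauss X * (1 - 2 * (soft_max X / B)) \<le> gauss X * (cutoff X)\<^sup>2"
      using gauss_pos[of X] by (intro mult_left_mono) auto
    then show "gauss X - 2 / B * (gauss X * soft_max X) \<le> gauss X * (cutoff X)\<^sup>2"
      by (simp add: algebra_simps)
  qed (use integrable_gauss_cutoff gauss_integral gauss_soft_max(1) in auto)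
  finally show ?thesis using pos by simp
qed

lemma mass_pos: "mass > 0"
  using mass_ge_half by simp

lemma dens_nonneg: "dens X \<ge> 0"
  using gauss_pos[of X] mass_pos by (simp add: dens_def less_imp_le)

lemma dens_pos_iff: "dens X > 0 \<longleftrightarrow> cutoff X > 0"
  using gauss_pos[of X] mass_pos cutoff_range(1)[of X]
  by (auto simp: dens_def zero_less_mult_iff zero_less_divide_iff)

lemma prob_space_dens: "prob_space law"
proof
  have int: "integrable leb dens"
    unfolding dens_def[abs_def] using integrable_gauss_cutoff by simp
  have "emeasure law (space law)
      = (\<integral>\<^sup>+X. ennreal (dens X) \<partial>leb)"
    by (simp add: emeasure_density cong: nn_integral_cong)
  also have "\<dots> = ennreal (\<integral>X. dens X \<partial>leb)"
    using int dens_nonneg by (intro nn_integral_eq_integral) auto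
  also have "(\<integral>X. dens X \<partial>leb) = 1"
    using mass_pos by (simp add: dens_def mass_def)
  finally show "emeasure law
      (space law) = 1" by simp
qed

lemma lin_le_of_dens_nonzero:
  assumes "dens X \<noteq> 0" "k \<in> K" "l > 0"
  shows "lin k X \<le> ln B / l"
proof -
  have "cutoff X > 0" using assms(1) dens_nonneg[of X] dens_pos_iff[of X] by linarith
  then have "soft_max X < B" using pos by (auto simp: cutoff_def field_simps max_def split: if_splits)
  moreover have "exp (l * lin k X) \<le> soft_max X"
    unfolding soft_max_def using assms(2) fin by (intro member_le_sum) auto
  ultimately have "ln (exp (l * lin k X)) \<le> ln B"
    by (intro iffD2[OF ln_le_cancel_iff]) (use pos in auto)
  then show ?thesis using assms(3) by (simp add: field_simps)
qed

lemma dens_has_derivative: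
  assumes "p \<in> P"
  shows "((\<lambda>t. dens (X(p := t))) has_real_derivative dens_deriv p X) (at (X p))"
proof -
  have lin': "((\<lambda>t. lin k (X(p := t))) has_real_derivative a k p) (at (X p))" for k
    unfolding lin_def sum_fun_upd[OF fin(1) assms, of "\<lambda>r x. a k r * x"]
    by (auto intro!: derivative_eq_intros)
  note [derivative_intros] = lin'
  have sm: "((\<lambda>t. soft_max (X(p := t))) has_real_derivative soft_max_deriv p X) (at (X p))"
    unfolding soft_max_def soft_max_deriv_def
    by (auto intro!: derivative_eq_intros sum.cong simp: ac_simps)
  have "((\<lambda>t. 1 - soft_max (X(p := t)) / B) has_real_derivative - (soft_max_deriv p X / B)) (at (X p))"
    using DERIV_diff[OF DERIV_const DERIV_cdivide[OF sm]] by simp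
  from DERIV_chain2[OF has_real_derivative_pos_part_power2 this]
  have cut: "((\<lambda>t. (cutoff (X(p := t)))\<^sup>2) has_real_derivative
      2 * cutoff X * (- (soft_max_deriv p X / B))) (at (X p))"
    unfolding cutoff_def by (simp only: fun_upd_triv)
  have split: "gauss (X(p := t)) = normal_density 0 s t * (\<Prod>r\<in>P - {p}. normal_density 0 s (X r))" for t
    unfolding gauss_def by (rule prod_fun_upd[OF fin(1) assms, of "\<lambda>_. normal_density 0 s"])
  have "((\<lambda>t. gauss (X(p := t))) has_real_derivative
      - X p / s\<^sup>2 * normal_density 0 s (X p) * (\<Prod>r\<in>P - {p}. normal_density 0 s (X r))) (at (X p))"
    unfolding split
    by (intro DERIV_cmult_right has_real_derivative_normal_density pos)
  then have g: "((\<lambda>t. gauss (X(p := t))) has_real_derivative - X p / s\<^sup>2 * gauss X) (at (X p))"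
    using split[of "X p"] by (simp add: mult.assoc)
  have "((\<lambda>t. gauss (X(p := t)) * (cutoff (X(p := t)))\<^sup>2) has_real_derivative
      - X p / s\<^sup>2 * gauss X * (cutoff (X(p := X p)))\<^sup>2
      + 2 * cutoff X * (- (soft_max_deriv p X / B)) * gauss (X(p := X p))) (at (X p))"
    by (intro DERIV_mult g cut)
  then have "((\<lambda>t. dens (X(p := t))) has_real_derivative
      (- X p / s\<^sup>2 * gauss X * (cutoff (X(p := X p)))\<^sup>2
      + 2 * cutoff X * (- (soft_max_deriv p X / B)) * gauss (X(p := X p))) / mass) (at (X p))"
    unfolding dens_def by (rule DERIV_cdivide)
  then show ?thesis
    by (rule DERIV_cong) (simp add: dens_deriv_def power2_eq_square algebra_simps diff_divide_distrib add_divide_distrib)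
qed

lemma partial_deriv_dens: "p \<in> P \<Longrightarrow> partial_deriv p dens X = dens_deriv p X"
  unfolding partial_deriv_def by (intro DERIV_imp_deriv dens_has_derivative)

lemma continuous_on_dens_deriv: "continuous_on S (dens_deriv p)"
proof -
  have coord [continuous_intros]: "continuous_on S (\<lambda>X::rmat. X r)" for r
    by (rule continuous_on_subset[OF continuous_on_product_coordinates]) simp
  show ?thesis
    unfolding dens_deriv_def cutoff_def soft_max_def soft_max_deriv_def lin_def gauss_def
      normal_density_def
    using pos mass_pos by (intro continuous_intros coord) auto
qed

lemma score_dens:
  assumes "p \<in> P"
  shows "score dens p X = (if 0 < dens X then dens_deriv p X / dens X else 0)"
proof (cases "0 < dens X")
  case True
  then have "((\<lambda>t. ln (dens (X(p := t)))) has_real_derivative 1 / dens X * dens_deriv p X) (at (X p))"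
    using DERIV_chain2[OF DERIV_ln_divide dens_has_derivative[OF assms, of X]] by simp
  with True show ?thesis
    by (simp add: score_def partial_deriv_def DERIV_imp_deriv)
qed (simp add: score_def)

text \<open>
  The gradient of the soft maximum is \<open>l\<close> times an exponentially weighted sum of the coefficient vectors. These
  have length at most \<open>1\<close>, so Cauchy-Schwarz with the exponential weights bounds its length by \<open>l\<close> times
  the soft maximum itself: the logarithm of the soft maximum is \<open>l\<close>-Lipschitz.
\<close>

lemma sum_soft_max_deriv_le: "(\<Sum>p\<in>P. (soft_max_deriv p X)\<^sup>2) \<le> (l * soft_max X)\<^sup>2"
proof -
  let ?e = "\<lambda>k. exp (l * lin k X)"
  have "(soft_max_deriv p X)\<^sup>2 \<le> soft_max X * (\<Sum>k\<in>K. l\<^sup>2 * (a k p)\<^sup>2 * ?e k)" for p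
  proof -
    \<comment> \<open>Each exponential is split into two square roots, one for each factor of Cauchy-Schwarz.\<close>
    have "(\<Sum>k\<in>K. sqrt (?e k) * (l * a k p * sqrt (?e k)))\<^sup>2 \<le>
        (\<Sum>k\<in>K. (sqrt (?e k))\<^sup>2) * (\<Sum>k\<in>K. (l * a k p * sqrt (?e k))\<^sup>2)"
      by (rule Cauchy_Schwarz_ineq_sum)
    then show ?thesis
      by (simp add: soft_max_deriv_def soft_max_def power_mult_distrib mult.left_commute[of "sqrt _"])
  qed
  then have "(\<Sum>p\<in>P. (soft_max_deriv p X)\<^sup>2) \<le>
      (\<Sum>p\<in>P. soft_max X * (\<Sum>k\<in>K. l\<^sup>2 * (a k p)\<^sup>2 * ?e k))"
    by (intro sum_mono)
  also have "\<dots> = soft_max X * (\<Sum>k\<in>K. l\<^sup>2 * ?e k * (\<Sum>p\<in>P. (a k p)\<^sup>2))"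
    by (subst sum_distrib_left[symmetric], subst sum.swap) (simp add: sum_distrib_left ac_simps)
  also have "\<dots> \<le> soft_max X * (\<Sum>k\<in>K. l\<^sup>2 * ?e k * 1)"
    using unit by (intro mult_left_mono sum_mono soft_max_nonneg) auto
  also have "\<dots> = (l * soft_max X)\<^sup>2"
    by (simp add: soft_max_def sum_distrib_left[symmetric] power2_eq_square)
  finally show ?thesis .
qed

text \<open>
  The score is singular where the cutoff \<open>h\<close> vanishes, but the left-hand side is the square of the derivative
  of the density divided by the density. The density carries the factor \<open>h\<^sup>2\<close> and its derivative still a factor
  \<open>h\<close>, so these factors cancel. The two terms on the right come from differentiating the Gaussian and
  the cutoff; the case distinction records that only points with \<open>soft_max X \<le> B\<close> contribute.
\<close>

lemma dens_times_score_power2_le: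
  assumes "p \<in> P"
  shows "dens X * (score dens p X)\<^sup>2 \<le> gauss X / mass *
    (2 * (X p)\<^sup>2 / s ^ 4 + (if soft_max X \<le> B then 8 * (soft_max_deriv p X)\<^sup>2 / B\<^sup>2 else 0))"
    (is "_ \<le> ?R")
proof (cases "0 < cutoff X")
  case False
  then have "dens X = 0" using dens_pos_iff[of X] dens_nonneg[of X] by linarith
  then show ?thesis using gauss_pos[of X] mass_pos pos by simp
next
  case True
  let ?u = "- X p / s\<^sup>2 * cutoff X" and ?w = "- 2 * soft_max_deriv p X / B"
  have B: "soft_max X \<le> B" using True pos by (simp add: cutoff_def field_simps max_def split: if_splits)
  have "dens X * (score dens p X)\<^sup>2 = (dens_deriv p X)\<^sup>2 / dens X"
    using True dens_pos_iff[of X] by (simp add: score_dens[OF assms] power2_eq_square)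
  also have "\<dots> = gauss X / mass * (?u + ?w)\<^sup>2"
    using True gauss_pos[of X] mass_pos
    by (simp add: dens_deriv_def dens_def power_mult_distrib power2_eq_square)
  also have "\<dots> \<le> gauss X / mass * (2 * (X p)\<^sup>2 / s ^ 4 + 8 * (soft_max_deriv p X)\<^sup>2 / B\<^sup>2)"
  proof (intro mult_left_mono)
    have "(u + w)\<^sup>2 \<le> 2 * u\<^sup>2 + 2 * w\<^sup>2" for u w :: real
      using zero_le_power2[of "u - w"] by (simp add: power2_eq_square algebra_simps)
    then have "(?u + ?w)\<^sup>2 \<le> 2 * ?u\<^sup>2 + 2 * ?w\<^sup>2" .
    moreover have "?u\<^sup>2 \<le> (X p / s\<^sup>2)\<^sup>2"
    proof -
      have "(X p / s\<^sup>2)\<^sup>2 * (cutoff X)\<^sup>2 \<le> (X p / s\<^sup>2)\<^sup>2"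
        using cutoff_range[of X] by (intro mult_left_le) (auto simp: power_le_one)
      then show ?thesis by (simp add: power_mult_distrib power_divide)
    qed
    then have "2 * ?u\<^sup>2 \<le> 2 * (X p)\<^sup>2 / s ^ 4"
      by (simp add: power_divide flip: power_mult)
    moreover have "2 * ?w\<^sup>2 = 8 * (soft_max_deriv p X)\<^sup>2 / B\<^sup>2"
      by (simp add: power_divide power_mult_distrib)
    ultimately show "(?u + ?w)\<^sup>2 \<le> 2 * (X p)\<^sup>2 / s ^ 4 + 8 * (soft_max_deriv p X)\<^sup>2 / B\<^sup>2"
      by linarith
  qed (use gauss_pos[of X] mass_pos in auto)
  finally show ?thesis using B by simp
qed

text \<open>
  Where the density is positive the soft maximum is at most \<open>B\<close>, so the gradient bound makes the contribution
  of the cutoff at most a multiple of \<open>l\<^sup>2\<close>, whatever \<open>B\<close> is.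
\<close>

lemma sum_dens_times_score_power2_le:
  "(\<Sum>p\<in>P. dens X * (score dens p X)\<^sup>2) \<le>
     (2 / (mass * s ^ 4)) * (\<Sum>p\<in>P. gauss X * (X p)\<^sup>2) + (8 * l\<^sup>2 / mass) * gauss X"
proof -
  let ?c = "\<lambda>p. if soft_max X \<le> B then 8 * (soft_max_deriv p X)\<^sup>2 / B\<^sup>2 else 0"
  have "(\<Sum>p\<in>P. ?c p) \<le> 8 * l\<^sup>2"
  proof (cases "soft_max X \<le> B")
    case True
    then have "(l * soft_max X)\<^sup>2 \<le> (l * B)\<^sup>2"
      using pos soft_max_nonneg[of X] by (intro power_mono mult_left_mono) auto
    with sum_soft_max_deriv_le[of X] have "(\<Sum>p\<in>P. (soft_max_deriv p X)\<^sup>2) \<le> l\<^sup>2 * B\<^sup>2"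
      by (simp add: power_mult_distrib)
    then have "8 / B\<^sup>2 * (\<Sum>p\<in>P. (soft_max_deriv p X)\<^sup>2) \<le> 8 / B\<^sup>2 * (l\<^sup>2 * B\<^sup>2)"
      by (intro mult_left_mono) auto
    then show ?thesis using True pos by (simp add: sum_distrib_left)
  qed simp
  then have *: "gauss X / mass * (\<Sum>p\<in>P. ?c p) \<le> gauss X / mass * (8 * l\<^sup>2)"
    using gauss_pos[of X] mass_pos by (intro mult_left_mono) auto
  have "(\<Sum>p\<in>P. dens X * (score dens p X)\<^sup>2) \<le>
      (\<Sum>p\<in>P. gauss X / mass * (2 * (X p)\<^sup>2 / s ^ 4 + ?c p))"
    by (intro sum_mono dens_times_score_power2_le)
  also have "\<dots> = (2 / (mass * s ^ 4)) * (\<Sum>p\<in>P. gauss X * (X p)\<^sup>2)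
      + gauss X / mass * (\<Sum>p\<in>P. ?c p)"
    by (simp only: distrib_left sum.distrib sum_distrib_left[symmetric])
       (simp add: sum_distrib_left sum_divide_distrib ac_simps)
  finally show ?thesis using * by (simp add: mult.commute)
qed

lemma measurable_score [measurable]:
  "p \<in> P \<Longrightarrow> score dens p \<in> borel_measurable leb"
  by (subst measurable_cong[OF score_dens]) measurable

lemma integrable_majorant:
  "integrable leb (\<lambda>X. (2 / (mass * s ^ 4)) * (\<Sum>p\<in>P. gauss X * (X p)\<^sup>2) + (8 * l\<^sup>2 / mass) * gauss X)"
  using gauss_second_moment gauss_integral
  by (intro Bochner_Integration.integrable_add integrable_mult_right Bochner_Integration.integrable_sum) auto

lemma integrable_dens_score:
  assumes "p \<in> P"
  shows "integrable leb (\<lambda>X. dens X * (score dens p X)\<^sup>2)"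
proof (rule Bochner_Integration.integrable_bound[OF integrable_majorant])
  note [measurable] = assms
  show "(\<lambda>X. dens X * (score dens p X)\<^sup>2) \<in> borel_measurable leb" by measurable
  have "dens X * (score dens p X)\<^sup>2 \<le> (\<Sum>p\<in>P. dens X * (score dens p X)\<^sup>2)" for X
    using assms fin dens_nonneg
    by (intro member_le_sum[of p P "\<lambda>p. dens X * (score dens p X)\<^sup>2"]) auto
  from order_trans[OF this sum_dens_times_score_power2_le]
  show "AE X in leb. norm (dens X * (score dens p X)\<^sup>2) \<le>
     norm ((2 / (mass * s ^ 4)) * (\<Sum>p\<in>P. gauss X * (X p)\<^sup>2) + (8 * l\<^sup>2 / mass) * gauss X)"
    using dens_nonneg by (intro AE_I2) (auto intro: order_trans[OF _ abs_ge_self])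
qed

lemma integrable_score_power2:
  assumes [measurable]: "p \<in> P"
  shows "integrable law (\<lambda>X. (score dens p X)\<^sup>2)"
  using integrable_dens_score[OF assms] dens_nonneg by (subst integrable_real_density) auto

lemma fisher_information_sum_le:
  "(\<Sum>p\<in>P. \<integral>X. (score dens p X)\<^sup>2 \<partial>law)
     \<le> 4 * card P / s\<^sup>2 + 16 * l\<^sup>2"
proof -
  have "(\<integral>X. (score dens p X)\<^sup>2 \<partial>law) =
      (\<integral>X. dens X * (score dens p X)\<^sup>2 \<partial>leb)" if [measurable]: "p \<in> P" for p
    using dens_nonneg by (subst integral_real_density) auto
  then have "(\<Sum>p\<in>P. \<integral>X. (score dens p X)\<^sup>2 \<partial>law)
      = (\<integral>X. (\<Sum>p\<in>P. dens X * (score dens p X)\<^sup>2) \<partial>leb)"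
    by (simp add: Bochner_Integration.integral_sum integrable_dens_score)
  also have "\<dots> \<le> (\<integral>X. (2 / (mass * s ^ 4)) * (\<Sum>p\<in>P. gauss X * (X p)\<^sup>2)
      + (8 * l\<^sup>2 / mass) * gauss X \<partial>leb)"
    by (intro integral_mono integrable_majorant sum_dens_times_score_power2_le
        Bochner_Integration.integrable_sum integrable_dens_score)
  also have "\<dots> = (2 / (mass * s ^ 4)) * (card P * s\<^sup>2) + 8 * l\<^sup>2 / mass"
    using gauss_second_moment gauss_integral
    by (simp add: Bochner_Integration.integral_sum Bochner_Integration.integrable_sum)
  also have "\<dots> = (2 * card P / s\<^sup>2 + 8 * l\<^sup>2) / mass"
    using pos by (simp add: add_divide_distrib power4_eq_xxxx power2_eq_square)
  also have "\<dots> \<le> (2 * card P / s\<^sup>2 + 8 * l\<^sup>2) / (1/2)"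
    using mass_ge_half pos by (intro divide_left_mono add_nonneg_nonneg) auto
  finally show ?thesis by simp
qed

end

section \<open>The distribution on matrices\<close>

text \<open>
  The coefficients of the linear form \<open>X \<mapsto> u \<cdot> Xv\<close> for the net points \<open>u\<close>, \<open>v\<close> given by a pair of
  integer vectors; the denominator is \<open>(4 \<surd>d)\<^sup>2\<close>.
\<close>

definition rank_one :: "nat \<Rightarrow> (nat \<Rightarrow> int) \<times> (nat \<Rightarrow> int) \<Rightarrow> rmat" where
  "rank_one d k p = of_int (fst k (fst p)) * of_int (snd k (snd p)) / (16 * real d)"

lemma rank_one_unit:
  assumes d: "d \<ge> 1" and k: "k \<in> net d \<times> net d"
  shows "(\<Sum>p\<in>{..<d} \<times> {..<d}. (rank_one d k p)\<^sup>2) \<le> 1"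
proof -
  let ?S = "\<lambda>z. \<Sum>i<d. (of_int (z i :: int))\<^sup>2 :: real"
  have "(\<Sum>p\<in>{..<d} \<times> {..<d}. (rank_one d k p)\<^sup>2) = ?S (fst k) * ?S (snd k) / (16 * real d)\<^sup>2"
    by (simp add: rank_one_def power_divide power_mult_distrib sum_product
        sum.cartesian_product sum_divide_distrib split_def)
  also have "\<dots> \<le> ((16 * real d) * (16 * real d)) / (16 * real d)\<^sup>2"
    using k net_point_norm(1)[OF d]
    by (intro divide_right_mono mult_mono) (auto intro!: sum_nonneg)
  also have "\<dots> = 1" using d by (simp add: power2_eq_square)
  finally show ?thesis .
qed

text \<open>
  The sharpness \<open>80 d\<close> matches \<open>B = exp (40 d)\<close>: the linear forms are then at most \<open>1/2\<close> on the
  support. With standard deviation \<open>1 / (80 \<surd>d)\<close> each exponential has expectation at most \<open>exp (d/2)\<close>,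
  and \<open>4 exp (36 d) exp (d/2) \<le> exp (40 d)\<close> because \<open>4 \<le> exp (7 d / 2)\<close>.
\<close>

lemma gaussian_cutoff_net:
  assumes d: "d \<ge> 1"
  shows "gaussian_cutoff ({..<d} \<times> {..<d}) (net d \<times> net d) (rank_one d)
    (1 / (80 * sqrt d)) (80 * real d) (exp (40 * real d))"
proof
  have expo: "(80 * real d)\<^sup>2 * (1 / (80 * sqrt d))\<^sup>2 / 2 = real d / 2"
    using d by (simp add: power_divide power_mult_distrib power2_eq_square)
  have card: "real (card (net d \<times> net d)) \<le> exp (18 * real d) * exp (18 * real d)"
    using card_net_le[of d] by (simp add: card_cartesian_product mult_mono)
  have "4 \<le> exp (7/2 * real d)"
    using exp_ge_add_one_self[of "7/2 * real d"] d by linarith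
  then have "4 * real (card (net d \<times> net d)) \<le>
      exp (7/2 * real d) * (exp (18 * real d) * exp (18 * real d))"
    using card by (intro mult_mono) auto
  then have "4 * card (net d \<times> net d) * exp ((80 * real d)\<^sup>2 * (1 / (80 * sqrt d))\<^sup>2 / 2)
      \<le> exp (7/2 * real d) * (exp (18 * real d) * exp (18 * real d)) * exp (real d / 2)"
    unfolding expo by (intro mult_right_mono) auto
  also have "\<dots> = exp (40 * real d)" by (simp add: exp_add[symmetric])
  finally show "4 * card (net d \<times> net d) * exp ((80 * real d)\<^sup>2 * (1 / (80 * sqrt d))\<^sup>2 / 2)
      \<le> exp (40 * real d)" .
qed (use d finite_net rank_one_unit in auto)

theorem lemma4p5:
  "\<exists>C::real. \<forall>d::nat. d \<ge> 1 \<longrightarrow>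
     (\<exists>(\<Upsilon> :: rmat measure) (q :: rmat \<Rightarrow> real).
        prob_space \<Upsilon> \<and> has_density d \<Upsilon> q \<and>
        continuously_differentiable d q \<and>
        (\<forall>X\<in>space (mat_lborel d). q X \<noteq> 0 \<longrightarrow> spectral_norm d X \<le> 1) \<and>
        (\<forall>i<d. \<forall>j<d. integrable \<Upsilon> (\<lambda>X. (score q (i, j) X)\<^sup>2)) \<and>
        fisher_trace d \<Upsilon> q = (\<Sum>i<d. \<Sum>j<d. (\<integral>X. (score q (i, j) X)\<^sup>2 \<partial>\<Upsilon>)) \<and>
        fisher_trace d \<Upsilon> q \<le> C * real d ^ 3)"
proof (rule exI[of _ 128000], intro allI impI)
  fix d :: nat
  assume d: "d \<ge> 1"
  let ?P = "{..<d} \<times> {..<d}"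
  interpret G: gaussian_cutoff ?P "net d \<times> net d" "rank_one d" "1 / (80 * sqrt d)"
    "80 * real d" "exp (40 * real d)"
    by (rule gaussian_cutoff_net[OF d])
  have "has_density d G.law G.dens"
    using G.dens_nonneg by (auto simp: has_density_def mat_lborel_def)
  moreover have "continuously_differentiable d G.dens"
    unfolding continuously_differentiable_def
  proof (intro ballI conjI)
    fix p X assume p: "p \<in> ?P"
    show "(\<lambda>t. G.dens (X(p := t))) differentiable (at (X p))"
      using G.dens_has_derivative[OF p] by (auto simp: real_differentiable_def)
    have "partial_deriv p G.dens = G.dens_deriv p"
      using G.partial_deriv_dens[OF p] by (rule ext)
    then show "continuous_on (space (mat_lborel d)) (partial_deriv p G.dens)"
      by (simp add: G.continuous_on_dens_deriv)
  qed
  moreover have "\<forall>X\<in>space (mat_lborel d). G.dens X \<noteq> 0 \<longrightarrow> spectral_norm d X \<le> 1"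
  proof (intro ballI impI)
    fix X assume nz: "G.dens X \<noteq> 0"
    have "spectral_norm d X \<le> 2 * (1/2)"
    proof (rule spectral_norm_le_of_net[OF d])
      fix z w assume "z \<in> net d" "w \<in> net d"
      then have "G.lin (z, w) X \<le> 1/2"
        using G.lin_le_of_dens_nonzero[OF nz, of "(z, w)"] d by simp
      then show "(\<Sum>i<d. \<Sum>j<d. of_int (z i) * of_int (w j) / (16 * real d) * X (i, j)) \<le> 1/2"
        by (simp add: G.lin_def rank_one_def sum.cartesian_product split_def)
    qed
    then show "spectral_norm d X \<le> 1" by simp
  qed
  moreover have "\<forall>i<d. \<forall>j<d. integrable G.law (\<lambda>X. (score G.dens (i, j) X)\<^sup>2)"
    using G.integrable_score_power2 by auto
  moreover have trace: "fisher_trace d G.law G.dens = (\<Sum>p\<in>?P. \<integral>X. (score G.dens p X)\<^sup>2 \<partial>G.law)"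
    by (simp add: fisher_trace_def fisher_information_def power2_eq_square)
  then have "fisher_trace d G.law G.dens =
      (\<Sum>i<d. \<Sum>j<d. (\<integral>X. (score G.dens (i, j) X)\<^sup>2 \<partial>G.law))"
    by (simp add: sum.cartesian_product split_def)
  moreover have "fisher_trace d G.law G.dens \<le> 128000 * real d ^ 3"
  proof -
    have "4 * card ?P / (1 / (80 * sqrt d))\<^sup>2 + 16 * (80 * real d)\<^sup>2
        = 25600 * real d ^ 3 + 102400 * real d ^ 2"
      using d by (simp add: card_cartesian_product power_divide power_mult_distrib
          power2_eq_square power3_eq_cube)
    moreover have "real d ^ 2 \<le> real d ^ 3" using d by (intro power_increasing) auto
    ultimately show ?thesis using G.fisher_information_sum_le trace by linarith
  qed
  ultimately show "\<exists>(\<Upsilon> :: rmat measure) (q :: rmat \<Rightarrow> real).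
        prob_space \<Upsilon> \<and> has_density d \<Upsilon> q \<and>
        continuously_differentiable d q \<and>
        (\<forall>X\<in>space (mat_lborel d). q X \<noteq> 0 \<longrightarrow> spectral_norm d X \<le> 1) \<and>
        (\<forall>i<d. \<forall>j<d. integrable \<Upsilon> (\<lambda>X. (score q (i, j) X)\<^sup>2)) \<and>
        fisher_trace d \<Upsilon> q = (\<Sum>i<d. \<Sum>j<d. (\<integral>X. (score q (i, j) X)\<^sup>2 \<partial>\<Upsilon>)) \<and>
        fisher_trace d \<Upsilon> q \<le> 128000 * real d ^ 3"
    using G.prob_space_dens by (intro exI[of _ G.law] exI[of _ G.dens]) simp
qed

end
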